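(* Suppose that $\aleph_1<\mathfrak{c}$. Then there is a $d$-separable space $X$ with $d(X)=\aleph_1$ that contains no dense $\sigma$-discrete sets of size $\aleph_1$.
   Context: All topological spaces are assumed to be $T_1$. A subset of $X$ is $\sigma$-discrete if it is the union of countably many subsets each of which is discrete in its subspace topology. A space is $d$-separable if it has a dense $\sigma$-discrete subset. $d(X)$ is the smallest cardinality of a dense subset of $X$, and $\mathfrak{c}=2^{\aleph_0}$. *)

theory Defs
  imports "HOL-Analysis.Analysis"
begin

unbundle cardinal_syntax

definition aleph_one :: "nat set rel"
  where "aleph_one = cardSuc natLeq"

definition continuum :: "(nat \<Rightarrow> bool) rel"
  where "continuum = ctwo ^c natLeq"

definition dense_in :: "'a topology \<Rightarrow> 'a set \<Rightarrow> bool"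
  where "dense_in X A \<longleftrightarrow> A \<subseteq> topspace X \<and> X closure_of A = topspace X"

definition discrete_in :: "'a topology \<Rightarrow> 'a set \<Rightarrow> bool"
  where "discrete_in X A \<longleftrightarrow> A \<subseteq> topspace X \<and> subtopology X A = discrete_topology A"

definition sigma_discrete_in :: "'a topology \<Rightarrow> 'a set \<Rightarrow> bool"
  where "sigma_discrete_in X A \<longleftrightarrow>
    (\<exists>D :: nat \<Rightarrow> 'a set. (\<forall>n. discrete_in X (D n)) \<and> A = (\<Union>n. D n))"

definition d_separable :: "'a topology \<Rightarrow> bool"
  where "d_separable X \<longleftrightarrow> (\<exists>A. dense_in X A \<and> sigma_discrete_in X A)"

definition least_dense_set :: "'a topology \<Rightarrow> 'a set \<Rightarrow> bool"
  where "least_dense_set X A \<longleftrightarrow> dense_in X A \<and> (\<forall>B. dense_in X B \<longrightarrow> |A| \<le>o |B| )"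

text \<open>The cardinal \<open>d(X)\<close>. Cardinals are well-orders up to \<open>=o\<close>, so the choice of the dense set
  of least cardinality is immaterial, and \<open>density_card_attained\<close> and \<open>density_card_le\<close>
  say that \<open>density_card X\<close> is the minimum.\<close>

definition density_card :: "'a topology \<Rightarrow> 'a rel"
  where "density_card X = |SOME A. least_dense_set X A|"

lemma least_dense_set_exists: "\<exists>A. least_dense_set X A"
proof -
  have "dense_in X (topspace X)"
    by (simp add: dense_in_def)
  then have "{|A| | A. dense_in X A} \<noteq> {}"
    by blast
  moreover have "\<forall>r \<in> {|A| | A. dense_in X A}. Card_order r"
    by (auto simp: card_of_Card_order)
  ultimately have "\<exists>r \<in> {|A| | A. dense_in X A}. \<forall>r' \<in> {|A| | A. dense_in X A}. r \<le>o r'"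
    by (rule exists_minim_Card_order)
  then show ?thesis
    unfolding least_dense_set_def by blast
qed

lemma density_card_attained: "\<exists>A. dense_in X A \<and> density_card X = |A|"
  using someI_ex[OF least_dense_set_exists[of X]]
  unfolding density_card_def least_dense_set_def by blast

lemma density_card_le: "dense_in X B \<Longrightarrow> density_card X \<le>o |B|"
  using someI_ex[OF least_dense_set_exists[of X]]
  unfolding density_card_def least_dense_set_def by blast

end

theory Submission
  imports Defs "HOL-Library.Countable_Set_Type"
begin

text \<open>Take a set \<open>Y\<close> of size \<open>\<aleph>\<^sub>1\<close> together with levels \<open>L 0, L 1, \<dots>\<close> of size \<open>\<cc>\<close>. Every nonempty
  open set contains all but countably many points of \<open>Y\<close> and, on all sufficiently high levels,
  all but at most \<open>\<aleph>\<^sub>1\<close> points; if it meets \<open>L n\<close>, this already holds on every level above \<open>n\<close>, but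
  nothing is required of its trace on \<open>L n\<close> itself. Hence each level is discrete and the union
  of the levels is dense. Discrete subsets of \<open>Y\<close> are countable, so a \<open>\<sigma>\<close>-discrete set of
  size \<open>\<aleph>\<^sub>1\<close> omits a nonempty open set.\<close>

section \<open>Cardinal arithmetic around \<open>aleph_one\<close>\<close>

lemma card_of_aleph_one: "|Field aleph_one| =o aleph_one"
  unfolding aleph_one_def
  by (simp add: natLeq_Card_order cardSuc_Card_order card_of_Field_ordIso)

lemma Card_order_aleph_one: "Card_order aleph_one"
  unfolding aleph_one_def by (simp add: natLeq_Card_order cardSuc_Card_order)

lemma infinite_Field_aleph_one: "infinite (Field aleph_one)"
  unfolding aleph_one_def
  by (subst cardSuc_finite[OF natLeq_Card_order]) (simp add: Field_natLeq)

lemma countable_iff_less_aleph_one: "countable A \<longleftrightarrow> |A| <o aleph_one"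
  unfolding countable_card_le_natLeq aleph_one_def
  by (rule cardSuc_ordLeq_ordLess[OF natLeq_Card_order card_of_Card_order, symmetric])

lemma countable_imp_le_aleph_one: "countable A \<Longrightarrow> |A| \<le>o aleph_one"
  by (simp add: countable_iff_less_aleph_one ordLess_imp_ordLeq)

lemma card_of_Un_le_aleph_one:
  "|A| \<le>o aleph_one \<Longrightarrow> |B| \<le>o aleph_one \<Longrightarrow> |A \<union> B| \<le>o aleph_one"
  by (rule card_of_Un_ordLeq_infinite_Field[OF infinite_Field_aleph_one])
     (auto simp: Card_order_aleph_one)

lemma le_aleph_one_mono: "|B| \<le>o aleph_one \<Longrightarrow> A \<subseteq> B \<Longrightarrow> |A| \<le>o aleph_one"
  using card_of_mono1 ordLeq_transitive by blast

section \<open>Neighbourhood criteria for discreteness and density\<close>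

lemma discrete_in_obtain_open:
  assumes "discrete_in X D" "x \<in> D"
  obtains V where "openin X V" "V \<inter> D = {x}"
proof -
  have "openin (subtopology X D) {x}"
    using assms by (simp add: discrete_in_def)
  then show thesis
    using that by (auto simp: openin_subtopology)
qed

lemma discrete_in_openI:
  assumes "D \<subseteq> topspace X" "\<And>x. x \<in> D \<Longrightarrow> \<exists>V. openin X V \<and> V \<inter> D = {x}"
  shows "discrete_in X D"
proof -
  have "topspace (subtopology X D) = D"
    using assms(1) by auto
  moreover have "openin (subtopology X D) {x}" if "x \<in> D" for x
    using assms(2)[OF that] by (auto simp: openin_subtopology)
  ultimately have "discrete_topology D = subtopology X D"
    by (simp add: discrete_topology_unique)
  then show ?thesis
    using assms(1) by (simp add: discrete_in_def)
qed

lemma dense_in_iff: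
  "dense_in X A \<longleftrightarrow> A \<subseteq> topspace X \<and> (\<forall>V. openin X V \<longrightarrow> V \<noteq> {} \<longrightarrow> A \<inter> V \<noteq> {})"
  by (auto simp: dense_in_def dense_intersects_open)

section \<open>The topology on \<open>Y\<close> and the levels\<close>

locale levelled_space =
  fixes Y :: "'a set" and L :: "nat \<Rightarrow> 'a set"
  assumes card_Y: "|Y| =o aleph_one"
    and card_L: "aleph_one <o |L n|"
    and Y_L: "Y \<inter> L n = {}"
    and L_L: "m \<noteq> n \<Longrightarrow> L m \<inter> L n = {}"
begin

definition almost :: "'a set \<Rightarrow> nat \<Rightarrow> bool"
  where "almost V m \<longleftrightarrow> |L m - V| \<le>o aleph_one"

text \<open>The existential clause does not follow from the last one: it excludes nonempty sets that
  meet no level. Without it \<open>Y\<close> would be open, and the union of the levels would not be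
  dense.\<close>

definition is_open :: "'a set \<Rightarrow> bool"
  where "is_open V \<longleftrightarrow> V \<subseteq> Y \<union> (\<Union>n. L n) \<and>
    (V \<noteq> {} \<longrightarrow> countable (Y - V) \<and> (\<exists>n. \<forall>m\<ge>n. almost V m)) \<and>
    (\<forall>n. V \<inter> L n \<noteq> {} \<longrightarrow> (\<forall>m>n. almost V m))"

definition space :: "'a topology"
  where "space = topology is_open"

lemma almost_mono: "almost V m \<Longrightarrow> V \<subseteq> W \<Longrightarrow> almost W m"
  unfolding almost_def by (erule le_aleph_one_mono) blast

lemma almost_Int: "almost V m \<Longrightarrow> almost W m \<Longrightarrow> almost (V \<inter> W) m"
  unfolding almost_def Diff_Int by (rule card_of_Un_le_aleph_one)

lemma almost_superset: "L m \<subseteq> V \<Longrightarrow> almost V m"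
  unfolding almost_def by (rule countable_imp_le_aleph_one) (simp add: Diff_eq_empty_iff[THEN iffD2])

lemma istopology_is_open: "istopology is_open"
  unfolding istopology_def
proof (intro conjI allI impI)
  fix V W assume V: "is_open V" and W: "is_open W"
  have "countable (Y - V \<inter> W) \<and> (\<exists>n. \<forall>m\<ge>n. almost (V \<inter> W) m)" if ne: "V \<inter> W \<noteq> {}"
  proof
    show "countable (Y - V \<inter> W)"
      using V W ne unfolding is_open_def Diff_Int by (auto intro!: countable_Un)
    obtain n n' where "\<forall>m\<ge>n. almost V m" "\<forall>m\<ge>n'. almost W m"
      using V W ne unfolding is_open_def by blast
    then have "\<forall>m\<ge>max n n'. almost (V \<inter> W) m"
      by (simp add: almost_Int)
    then show "\<exists>n. \<forall>m\<ge>n. almost (V \<inter> W) m" ..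
  qed
  moreover have "\<forall>n. V \<inter> W \<inter> L n \<noteq> {} \<longrightarrow> (\<forall>m>n. almost (V \<inter> W) m)"
    \<comment> \<open>A common point of \<open>V\<close>, \<open>W\<close> and \<open>L n\<close>
      activates the last clause for both sets with the same \<open>n\<close>.\<close>
    using V W unfolding is_open_def by (blast intro: almost_Int)
  ultimately show "is_open (V \<inter> W)"
    using V unfolding is_open_def by blast
next
  fix \<K> assume \<K>: "\<forall>K\<in>\<K>. is_open K"
  \<comment> \<open>All largeness conditions pass to supersets, so a single member of the family
    carries each of them: any nonempty member for the first two, a member meeting \<open>L n\<close>
    for the last.\<close>
  have mono: "almost (\<Union>\<K>) m" if "K \<in> \<K>" "almost K m" for K m
    using that(2) by (rule almost_mono) (use that(1) in blast)
  have "countable (Y - \<Union>\<K>) \<and> (\<exists>n. \<forall>m\<ge>n. almost (\<Union>\<K>) m)" if "\<Union>\<K> \<noteq> {}"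
  proof -
    obtain K where K: "K \<in> \<K>" "K \<noteq> {}"
      using \<open>\<Union>\<K> \<noteq> {}\<close> by blast
    then have "countable (Y - K)" and ex: "\<exists>n. \<forall>m\<ge>n. almost K m"
      using \<K> unfolding is_open_def by auto
    have "countable (Y - \<Union>\<K>)"
      by (rule countable_subset[OF _ \<open>countable (Y - K)\<close>]) (use K(1) in blast)
    then show ?thesis
      using ex mono[OF K(1)] by blast
  qed
  moreover have "almost (\<Union>\<K>) m" if meets: "\<Union>\<K> \<inter> L n \<noteq> {}" and "m > n" for n m
  proof -
    obtain K where K: "K \<in> \<K>" "K \<inter> L n \<noteq> {}"
      using meets by blast
    then have "almost K m"
      using \<K> \<open>m > n\<close> unfolding is_open_def by blast
    then show ?thesis
      using mono K(1) by blast
  qed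
  moreover have "\<Union>\<K> \<subseteq> Y \<union> (\<Union>n. L n)"
    by (rule Union_least) (use \<K> in \<open>simp add: is_open_def\<close>)
  ultimately show "is_open (\<Union>\<K>)"
    unfolding is_open_def by blast
qed

lemma openin_space: "openin space V \<longleftrightarrow> is_open V"
  by (simp add: space_def istopology_is_open topology_inverse')

lemma topspace_space: "topspace space = Y \<union> (\<Union>n. L n)"
proof
  show "topspace space \<subseteq> Y \<union> (\<Union>n. L n)"
    using openin_topspace[of space] unfolding openin_space is_open_def by blast
  have "is_open (Y \<union> (\<Union>n. L n))"
    unfolding is_open_def by (auto intro: almost_superset simp: Diff_eq_empty_iff[THEN iffD2])
  then show "Y \<union> (\<Union>n. L n) \<subseteq> topspace space"
    by (intro openin_subset) (simp only: openin_space)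
qed

section \<open>Small sets, the T1 axiom and the density\<close>

lemma uncountable_Y: "uncountable Y"
  unfolding countable_iff_less_aleph_one using card_Y not_ordLess_ordIso by blast

lemma almost_imp_meets:
  assumes "almost V m"
  shows "V \<inter> L m \<noteq> {}"
proof
  assume "V \<inter> L m = {}"
  then have "L m - V = L m"
    by blast
  then show False
    using assms not_ordLess_ordLeq[OF card_L[of m]] by (simp add: almost_def)
qed

text \<open>The removed points fit into the exceptional sets that openness tolerates: countably many
  in \<open>Y\<close>, at most \<open>aleph_one\<close> on each level. With \<open>A\<close> a
  singleton this gives T1; in general it supplies the open set that witnesses non-density.\<close>

lemma is_open_minus_small:
  assumes "countable (A \<inter> Y)" "|A| \<le>o aleph_one"
  shows "openin space (topspace space - A)"
proof -
  have "almost (topspace space - A) m" for m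
    unfolding almost_def topspace_space by (rule le_aleph_one_mono[OF assms(2)]) blast
  moreover have "Y - (topspace space - A) = A \<inter> Y"
    unfolding topspace_space by blast
  ultimately show ?thesis
    using assms(1) by (auto simp: openin_space is_open_def topspace_space)
qed

lemma not_dense_in_small:
  assumes "countable (A \<inter> Y)" "|A| \<le>o aleph_one"
  shows "\<not> dense_in space A"
proof -
  have "\<not> Y \<subseteq> A"
    using assms(1) uncountable_Y by (auto simp: Int_absorb1)
  then have "topspace space - A \<noteq> {}"
    unfolding topspace_space by blast
  then show ?thesis
    using is_open_minus_small[OF assms] unfolding dense_in_iff by blast
qed

lemma t1_space_space: "t1_space space"
  unfolding t1_space_closedin_singleton closedin_def
  by (auto intro!: is_open_minus_small countable_imp_le_aleph_one)

lemma dense_in_Y: "dense_in space Y"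
proof -
  have "Y \<inter> V \<noteq> {}" if "openin space V" "V \<noteq> {}" for V
  proof
    assume "Y \<inter> V = {}"
    then have "Y - V = Y"
      by blast
    then show False
      using that uncountable_Y by (simp add: openin_space is_open_def)
  qed
  then show ?thesis
    unfolding dense_in_iff topspace_space by blast
qed

text \<open>\<open>Y\<close> gives the upper bound. For the lower bound, a countable set is small in
  the sense of \<open>not_dense_in_small\<close>, so a dense set is uncountable.\<close>

lemma density_card_space: "density_card space =o aleph_one"
proof -
  obtain A where A: "dense_in space A" "density_card space = |A|"
    using density_card_attained by blast
  have "|A| \<le>o aleph_one"
    using density_card_le[OF dense_in_Y] A(2) card_Y ordLeq_ordIso_trans by auto
  moreover have "uncountable A"
    using A(1) not_dense_in_small[of A] countable_imp_le_aleph_one by blast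
  ultimately show ?thesis
    unfolding A(2) countable_iff_less_aleph_one ordLeq_iff_ordLess_or_ordIso by blast
qed

section \<open>Discrete and sigma-discrete sets\<close>

lemma discrete_in_level: "discrete_in space (L n)"
proof (rule discrete_in_openI)
  fix x assume x: "x \<in> L n"
  \<comment> \<open>On \<open>L n\<close> only \<open>x\<close> is kept. Since \<open>?V\<close>
    meets no level below \<open>n\<close>, the last clause concerns only levels strictly above
    \<open>n\<close>, which lie entirely in \<open>?V\<close>; \<open>Suc n\<close> serves as the
    threshold in the existential clause.\<close>
  let ?V = "insert x (Y \<union> (\<Union>m\<in>{n<..}. L m))"
  have "k \<ge> n" if "?V \<inter> L k \<noteq> {}" for k
  proof (rule ccontr)
    assume "\<not> k \<ge> n"
    then have "L m \<inter> L k = {}" if "m \<ge> n" for m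
      using L_L that by simp
    then have "x \<notin> L k" "(\<Union>m\<in>{n<..}. L m) \<inter> L k = {}"
      using x by (fastforce, simp add: UN_extend_simps)
    then show False
      using that Y_L[of k] by blast
  qed
  moreover have "almost ?V m" if "m > n" for m
    using that by (intro almost_superset) blast
  moreover have "?V \<subseteq> Y \<union> (\<Union>n. L n)"
    using x by blast
  moreover have "countable (Y - ?V)"
    by (simp add: Diff_eq_empty_iff[THEN iffD2] subset_insertI2)
  ultimately have "is_open ?V"
    unfolding is_open_def by (metis Suc_le_lessD le_less_trans)
  moreover have "?V \<inter> L n = {x}"
  proof -
    have "L m \<inter> L n = {}" if "m > n" for m
      using L_L that by simp
    then show ?thesis
      using x Y_L[of n] by blast
  qed
  ultimately show "\<exists>V. openin space V \<and> V \<inter> L n = {x}"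
    unfolding openin_space by blast
qed (auto simp: topspace_space)

lemma d_separable_space: "d_separable space"
proof -
  have "(\<Union>n. L n) \<inter> V \<noteq> {}" if V: "openin space V" "V \<noteq> {}" for V
  proof -
    obtain n where "almost V n"
      using V unfolding openin_space is_open_def by blast
    then show ?thesis
      using almost_imp_meets[of V n] by blast
  qed
  then have "dense_in space (\<Union>n. L n)"
    unfolding dense_in_iff topspace_space by blast
  moreover have "sigma_discrete_in space (\<Union>n. L n)"
    unfolding sigma_discrete_in_def using discrete_in_level by blast
  ultimately show ?thesis
    unfolding d_separable_def by blast
qed

text \<open>One neighbourhood \<open>V\<close> isolating one point \<open>x\<close> of
  \<open>D\<close> suffices: the other points of \<open>D\<close> avoid \<open>V\<close>, and
  \<open>V\<close> omits only countably many points of \<open>Y\<close>.\<close>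

lemma countable_discrete_Int_Y:
  assumes "discrete_in space D"
  shows "countable (D \<inter> Y)"
proof (cases "D = {}")
  case False
  then obtain x where "x \<in> D"
    by blast
  then obtain V where V: "openin space V" "V \<inter> D = {x}"
    by (rule discrete_in_obtain_open[OF assms])
  then have "V \<noteq> {}"
    by blast
  then have "countable (insert x (Y - V))"
    using V(1) by (simp add: openin_space is_open_def)
  then show ?thesis
    by (rule countable_subset[rotated]) (use V(2) in blast)
qed simp

lemma not_dense_sigma_discrete:
  assumes "sigma_discrete_in space A" "|A| \<le>o aleph_one"
  shows "\<not> dense_in space A"
proof (rule not_dense_in_small)
  obtain D :: "nat \<Rightarrow> 'a set" where "\<And>n. discrete_in space (D n)" "A = (\<Union>n. D n)"
    using assms(1) unfolding sigma_discrete_in_def by blast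
  then show "countable (A \<inter> Y)"
    using countable_discrete_Int_Y by (simp add: UN_extend_simps(4) del: UN_simps)
qed (rule assms(2))

end

section \<open>Realization of the levels by sets of reals\<close>

lemma continuum_card_of: "continuum =o |UNIV :: nat set set|"
  using card_of_Pow_Func[of "UNIV :: nat set"] ordIso_symmetric
  unfolding continuum_def cexp_def ctwo_def by (simp add: Field_card_of Field_natLeq)

theorem proposition4p4:
  assumes "aleph_one <o continuum"
  shows "\<exists>X :: real set topology.
    t1_space X \<and> d_separable X \<and> density_card X =o aleph_one \<and>
    \<not> (\<exists>A. dense_in X A \<and> sigma_discrete_in X A \<and> |A| =o aleph_one)"
proof -
  \<comment> \<open>The elements of \<open>Field aleph_one\<close> are sets of naturals, copied here
    as sets of nonnegative reals. Level \<open>n\<close> consists of copies of all sets of naturals,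
    tagged with the negative number \<open>- 1 - real n\<close>; the shift by 1 keeps the tag of
    level 0 away from 0.\<close>
  define Y where "Y = image real ` Field aleph_one"
  define L where "L n = range (\<lambda>S :: nat set. insert (- 1 - real n) (real ` S))" for n
  have neg: "- 1 - real n \<noteq> real k" for n k
    by linarith
  have notin: "- 1 - real n \<notin> real ` S" for n S
    using neg by blast
  interpret levelled_space Y L
  proof
    have "inj_on (image real) (Field aleph_one)"
      by (auto simp: inj_on_def inj_image_eq_iff inj_of_nat)
    then have "bij_betw (image real) (Field aleph_one) Y"
      by (simp add: Y_def bij_betw_def)
    then show "|Y| =o aleph_one"
      using card_of_ordIsoI card_of_aleph_one ordIso_symmetric ordIso_transitive by blast
  next
    fix n
    have "inj (\<lambda>S :: nat set. insert (- 1 - real n) (real ` S))"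
      by (rule injI) (metis notin insert_ident inj_image_eq_iff inj_of_nat)
    then have "bij_betw (\<lambda>S :: nat set. insert (- 1 - real n) (real ` S)) UNIV (L n)"
      by (simp add: L_def bij_betw_def)
    then have "|UNIV :: nat set set| =o |L n|"
      by (rule card_of_ordIsoI)
    then show "aleph_one <o |L n|"
      \<comment> \<open>Each level has the size of the continuum, and here the assumption that this
        exceeds \<open>aleph_one\<close> enters.\<close>
      by (rule ordLess_ordIso_trans[OF ordLess_ordIso_trans[OF assms continuum_card_of]])
  next
    show "Y \<inter> L n = {}" for n
      unfolding Y_def L_def using notin[of n] by blast
  next
    fix m n :: nat assume "m \<noteq> n"
    \<comment> \<open>The tag of level \<open>m\<close> belongs to every member of
      \<open>L m\<close> and to no member of \<open>L n\<close>.\<close>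
    then have "- 1 - real m \<notin> insert (- 1 - real n) (real ` S)" for S
      using notin by simp
    then show "L m \<inter> L n = {}"
      unfolding L_def by blast
  qed
  have "\<not> (\<exists>A. dense_in space A \<and> sigma_discrete_in space A \<and> |A| =o aleph_one)"
    using not_dense_sigma_discrete ordIso_imp_ordLeq by blast
  then show ?thesis
    using t1_space_space d_separable_space density_card_space by blast
qed

end
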